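(* Let $B_3$ be the braid group on three strands with generators $\sigma_1,\sigma_2$, let $F_2=\langle\sigma_1^2,\sigma_2^2\rangle\subset B_3$, and let $\preceq_C$ be the ordering of $F_2$ with positive cone $P=P_{DD}\cap F_2$, where $P_{DD}\subset B_3$ is the positive cone of the Dubrovina–Dubrovin ordering. Then $\preceq_C$ is not an accumulation point of its conjugates in $\mathcal{LO}(F_2)$. Specifically, no conjugates of $\preceq_C$ distinct from $\preceq_C$ lie inside the open set $U_{\sigma_2^{-2}}\subset\mathcal{LO}(F_2)$.
   Context: $B_3=\langle\sigma_1,\sigma_2\mid \sigma_1\sigma_2\sigma_1=\sigma_2\sigma_1\sigma_2\rangle$. A word in $\sigma_1^{\pm1},\sigma_2^{\pm1}$ is $1$-positive if $\sigma_1$ occurs in it, and only with positive exponents; a word in $\sigma_2^{\pm1}$ only is $2$-positive if $\sigma_2$ occurs in it, and only with positive exponents. A braid is $i$-positive if it is represented by some $i$-positive word; $P_i\subset B_3$ denotes the set of $i$-positive braids (so $P_2=\{\sigma_2^k:k>0\}$), and $P_i^{-1}$ the set of inverses of its elements. The Dubrovina–Dubrovin positive cone is $P_{DD}=P_1\cup P_2^{-1}$; it is known to be the positive cone of an ordering of $B_3$. The subgroup $\langle\sigma_1^2,\sigma_2^2\rangle$ of $B_3$ is known to be free on the two generators $\sigma_1^2,\sigma_2^2$. An ordering on a group $\Gamma$ is a total order relation invariant under left multiplication; its positive cone is the set of elements $\succ1$, which determines it ($a\prec b$ iff $a^{-1}b$ is in the positive cone). $\mathcal{LO}(\Gamma)$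 is the set of all orderings on $\Gamma$, with the topology having as a subbasis the sets $U_f=\{\preceq\,:\,f\succ1\}$, $f\neq1$. The conjugates of an ordering with positive cone $P$ are the orderings with positive cones $\beta P\beta^{-1}$, $\beta\in\Gamma$ (here $\Gamma=F_2$). An ordering is an accumulation point of its conjugates if every neighborhood of it contains a conjugate of it distinct from itself. *)

theory Defs
  imports "HOL-Analysis.Analysis" "HOL-Algebra.Algebra"
begin

section \<open>Left orderings of a group\<close>

text \<open>An ordering is represented by its (reflexive) order relation on the carrier.\<close>

definition left_orderings :: "('a, 'b) monoid_scheme \<Rightarrow> 'a rel set" where
  "left_orderings G =
     {r. linear_order_on (carrier G) r \<and>
         (\<forall>f\<in>carrier G. \<forall>g h. (g, h) \<in> r \<longrightarrow> (f \<otimes>\<^bsub>G\<^esub> g, f \<otimes>\<^bsub>G\<^esub> h) \<in> r)}"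

definition positive_cone :: "('a, 'b) monoid_scheme \<Rightarrow> 'a rel \<Rightarrow> 'a set" where
  "positive_cone G r = {g \<in> carrier G. g \<noteq> \<one>\<^bsub>G\<^esub> \<and> (\<one>\<^bsub>G\<^esub>, g) \<in> r}"

definition cone_order :: "('a, 'b) monoid_scheme \<Rightarrow> 'a set \<Rightarrow> 'a rel" where
  "cone_order G P =
     {(a, b). a \<in> carrier G \<and> b \<in> carrier G \<and> (a = b \<or> inv\<^bsub>G\<^esub> a \<otimes>\<^bsub>G\<^esub> b \<in> P)}"

definition pos_open :: "('a, 'b) monoid_scheme \<Rightarrow> 'a \<Rightarrow> 'a rel set" where
  "pos_open G f = {r \<in> left_orderings G. f \<in> positive_cone G r}"

text \<open>
  The whole space is inserted as the empty intersection of subbasic sets; this only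
  matters for the trivial group, where there are no subbasic sets at all.
\<close>

definition LO_topology :: "('a, 'b) monoid_scheme \<Rightarrow> 'a rel topology" where
  "LO_topology G =
     topology_generated_by
       (insert (left_orderings G) (pos_open G ` (carrier G - {\<one>\<^bsub>G\<^esub>})))"

definition conjugates :: "('a, 'b) monoid_scheme \<Rightarrow> 'a rel \<Rightarrow> 'a rel set" where
  "conjugates G r =
     {r' \<in> left_orderings G. \<exists>\<beta>\<in>carrier G.
        positive_cone G r' = (\<beta> <#\<^bsub>G\<^esub> positive_cone G r) #>\<^bsub>G\<^esub> inv\<^bsub>G\<^esub> \<beta>}"

lemma topspace_LO_topology [simp]: "topspace (LO_topology G) = left_orderings G"
  by (auto simp: LO_topology_def pos_open_def topology_generated_by_topspace)

lemma openin_pos_open: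
  assumes "f \<in> carrier G" "f \<noteq> \<one>\<^bsub>G\<^esub>"
  shows "openin (LO_topology G) (pos_open G f)"
  using assms unfolding LO_topology_def by (intro topology_generated_by_Basis) auto

text \<open>An ordering is determined by its positive cone.\<close>

lemma cone_order_positive_cone:
  fixes G (structure)
  assumes "group G" "r \<in> left_orderings G"
  shows "cone_order G (positive_cone G r) = r"
proof -
  interpret group G by fact
  have sub: "r \<subseteq> carrier G \<times> carrier G" and refl: "refl_on (carrier G) r"
    and inv: "\<And>f g h. \<lbrakk>f \<in> carrier G; (g, h) \<in> r\<rbrakk> \<Longrightarrow> (f \<otimes> g, f \<otimes> h) \<in> r"
    using assms(2)
    by (auto simp: left_orderings_def linear_order_on_def partial_order_on_def preorder_on_def)
  have "(a, b) \<in> r \<longleftrightarrow> (\<one>, inv a \<otimes> b) \<in> r" if "a \<in> carrier G" "b \<in> carrier G" for a b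
  proof
    show "(\<one>, inv a \<otimes> b) \<in> r" if "(a, b) \<in> r"
      using inv[OF _ that, of "inv a"] \<open>a \<in> carrier G\<close> by simp
    show "(a, b) \<in> r" if "(\<one>, inv a \<otimes> b) \<in> r"
      using inv[OF _ that, of a] \<open>a \<in> carrier G\<close> \<open>b \<in> carrier G\<close> by (simp add: m_assoc[of a "inv a" b, symmetric])
  qed
  moreover have "inv a \<otimes> b = \<one> \<longleftrightarrow> a = b" if "a \<in> carrier G" "b \<in> carrier G" for a b
    using that by (metis inv_solve_left' one_closed r_one)
  moreover have "(a, a) \<in> r" if "a \<in> carrier G" for a
    using refl that by (rule refl_onD)
  ultimately have "(a, b) \<in> cone_order G (positive_cone G r) \<longleftrightarrow> (a, b) \<in> r"
    if "a \<in> carrier G" "b \<in> carrier G" for a b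
    using that unfolding cone_order_def positive_cone_def mem_Collect_eq case_prod_conv
    by (metis inv_closed m_closed)
  moreover have "cone_order G (positive_cone G r) \<subseteq> carrier G \<times> carrier G"
    by (auto simp: cone_order_def)
  ultimately show ?thesis
    using sub by blast
qed

section \<open>The braid group on three strands\<close>

datatype gen = S1 | S2

text \<open>The letter \<open>(s, True)\<close> is the generator \<open>s\<close>, and \<open>(s, False)\<close> its inverse.\<close>

type_synonym word = "(gen \<times> bool) list"

inductive braid_eq :: "word \<Rightarrow> word \<Rightarrow> bool" where
  cancel: "braid_eq (u @ [(s, b), (s, \<not> b)] @ v) (u @ v)"
| braid: "braid_eq (u @ [(S1, True), (S2, True), (S1, True)] @ v)
                   (u @ [(S2, True), (S1, True), (S2, True)] @ v)"
| refl: "braid_eq u u"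
| sym: "braid_eq u v \<Longrightarrow> braid_eq v u"
| trans: "braid_eq u v \<Longrightarrow> braid_eq v w \<Longrightarrow> braid_eq u w"

lemma braid_eq_context: "braid_eq u v \<Longrightarrow> braid_eq (x @ u @ y) (x @ v @ y)"
proof (induction rule: braid_eq.induct)
  case (cancel u s b v)
  then show ?case using braid_eq.cancel[of "x @ u" s b "v @ y"] by simp
next
  case (braid u v)
  then show ?case using braid_eq.braid[of "x @ u" "v @ y"] by simp
next
  case (refl u)
  show ?case by (rule braid_eq.refl)
next
  case (sym u v)
  then show ?case by (rule_tac braid_eq.sym)
next
  case (trans u v w)
  then show ?case by (rule_tac braid_eq.trans)
qed

lemma braid_eq_append:
  assumes "braid_eq u u'" "braid_eq v v'"
  shows "braid_eq (u @ v) (u' @ v')"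
  using braid_eq_context[OF assms(1), of "[]" v] braid_eq_context[OF assms(2), of u' "[]"]
  by (simp, rule_tac braid_eq.trans)

quotient_type braid3 = word / braid_eq
  by (intro equivpI reflpI sympI transpI) (fact braid_eq.refl, erule braid_eq.sym, erule (1) braid_eq.trans)

lift_definition braid_of :: "word \<Rightarrow> braid3" is "\<lambda>w. w" .

lift_definition braid_mult :: "braid3 \<Rightarrow> braid3 \<Rightarrow> braid3" is "(@)"
  by (rule braid_eq_append)

definition B3 :: "braid3 monoid" where
  "B3 = \<lparr>carrier = UNIV, mult = braid_mult, one = braid_of []\<rparr>"

lemma braid_eq_inverse: "braid_eq (rev (map (\<lambda>(s, b). (s, \<not> b)) w) @ w) []"
proof (induction w)
  case (Cons l w)
  obtain s b where l: "l = (s, b)" by force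
  show ?case
    using braid_eq.trans[OF braid_eq.cancel[of "rev (map (\<lambda>(s, b). (s, \<not> b)) w)" s "\<not> b" w] Cons]
    by (simp add: l)
qed (simp add: braid_eq.refl)

lemma group_B3: "group B3"
proof (rule groupI)
  fix x assume "x \<in> carrier B3"
  show "\<exists>y\<in>carrier B3. y \<otimes>\<^bsub>B3\<^esub> x = \<one>\<^bsub>B3\<^esub>"
    unfolding B3_def by simp (transfer, use braid_eq_inverse in blast)
next
  fix x y z assume "x \<in> carrier B3" "y \<in> carrier B3" "z \<in> carrier B3"
  show "x \<otimes>\<^bsub>B3\<^esub> y \<otimes>\<^bsub>B3\<^esub> z = x \<otimes>\<^bsub>B3\<^esub> (y \<otimes>\<^bsub>B3\<^esub> z)"
    unfolding B3_def by simp (transfer, simp add: braid_eq.refl)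
next
  fix x assume "x \<in> carrier B3"
  show "\<one>\<^bsub>B3\<^esub> \<otimes>\<^bsub>B3\<^esub> x = x"
    unfolding B3_def by simp (transfer, simp add: braid_eq.refl)
qed (auto simp: B3_def)

definition \<sigma>\<^sub>1 :: braid3 where "\<sigma>\<^sub>1 = braid_of [(S1, True)]"
definition \<sigma>\<^sub>2 :: braid3 where "\<sigma>\<^sub>2 = braid_of [(S2, True)]"

section \<open>The Dubrovina--Dubrovin positive cone\<close>

definition one_positive_word :: "word \<Rightarrow> bool" where
  "one_positive_word w \<longleftrightarrow> (S1, True) \<in> set w \<and> (S1, False) \<notin> set w"

definition two_positive_word :: "word \<Rightarrow> bool" where
  "two_positive_word w \<longleftrightarrow>
     fst ` set w \<subseteq> {S2} \<and> (S2, True) \<in> set w \<and> (S2, False) \<notin> set w"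

definition P\<^sub>1 :: "braid3 set" where "P\<^sub>1 = braid_of ` {w. one_positive_word w}"
definition P\<^sub>2 :: "braid3 set" where "P\<^sub>2 = braid_of ` {w. two_positive_word w}"

definition P_DD :: "braid3 set" where "P_DD = P\<^sub>1 \<union> set_inv\<^bsub>B3\<^esub> P\<^sub>2"

section \<open>The free subgroup and its induced ordering\<close>

definition F2 :: "braid3 monoid" where
  "F2 = B3\<lparr>carrier := generate B3 {\<sigma>\<^sub>1 [^]\<^bsub>B3\<^esub> (2::nat), \<sigma>\<^sub>2 [^]\<^bsub>B3\<^esub> (2::nat)}\<rparr>"

lemma group_F2: "group F2"
  unfolding F2_def
  by (intro subgroup.subgroup_is_group group.generate_is_subgroup group_B3) (simp add: B3_def)

definition ord_C :: "braid3 rel" where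
  "ord_C = cone_order F2 (P_DD \<inter> carrier F2)"

end

theory Submission
  imports Defs
begin

text \<open>
  Conjugation by an element of the form \<open>z h\<close>, with \<open>z\<close> central in \<open>B3\<close> and \<open>h\<close> a power of
  \<open>\<sigma>\<^sub>2\<close>, maps \<open>P\<^sub>1\<close> to itself and fixes every power of \<open>\<sigma>\<^sub>2\<close>, so it preserves \<open>P_DD\<close>
  (lemma \<open>conj_P_DD\<close>). No other conjugate of the ordering makes \<open>\<sigma>\<^sub>2\<^sup>-\<^sup>2\<close> positive, by the
  dichotomy \<open>conj_sigma2\<close>: every braid \<open>\<beta>\<close> either has the form \<open>z h\<close> or makes \<open>\<beta>\<^sup>-\<^sup>1 \<sigma>\<^sub>2 \<beta>\<close>
  1-positive. In the second case \<open>\<beta>\<^sup>-\<^sup>1 \<sigma>\<^sub>2\<^sup>2 \<beta>\<close> is 1-positive too, so \<open>\<sigma>\<^sub>2\<^sup>2\<close> lies in the cone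
  conjugated by \<open>\<beta>\<close>; being the cone of an ordering, it cannot also contain \<open>\<sigma>\<^sub>2\<^sup>-\<^sup>2\<close>.

  Geometrically, \<open>B3\<close> acts on the universal cover of the real projective line; \<open>\<sigma>\<^sub>2\<close> fixes a point
  \<open>p\<close> and moves no point to the left, and the braids that move \<open>p\<close> to the right are the 1-positive
  ones. Hence \<open>\<beta>\<^sup>-\<^sup>1 \<sigma>\<^sub>2 \<beta>\<close> moves \<open>p\<close> to the right unless \<open>\<sigma>\<^sub>2\<close> fixes the image of \<open>p\<close> under
  \<open>\<beta>\<close>, and the fixed points of \<open>\<sigma>\<^sub>2\<close> are the translates of \<open>p\<close> by the center. The proof below is an
  algebraic version of this. The matrices of \<open>\<sigma>\<^sub>1\<close> and \<open>\<sigma>\<^sub>2\<^sup>-\<^sup>1\<close> generate the monoid of nonnegative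
  integer matrices of determinant one, which reaches all positive rational slopes, and the half-twist
  \<open>\<Delta>\<close> exchanges positive and negative slopes. This suggests the normal form \<open>braid_decomp\<close>: up to a
  central factor on the left and a power of \<open>\<sigma>\<^sub>2\<close> on the right, each braid is \<open>w\<close> or \<open>\<Delta> w\<close> with
  \<open>w\<close> in the monoid generated by \<open>\<sigma>\<^sub>1\<close> and \<open>\<sigma>\<^sub>2\<^sup>-\<^sup>1\<close>. For such \<open>w\<close>, moving \<open>\<Delta>\<close> across
  \<open>w\<^sup>-\<^sup>1\<close> exchanges \<open>\<sigma>\<^sub>1\<close> and \<open>\<sigma>\<^sub>2\<close> and thereby turns \<open>w\<^sup>-\<^sup>1\<close> into an element of the same
  monoid (lemma \<open>alt_inv_Delta\<close>). This makes the conjugates of \<open>\<sigma>\<^sub>1\<close> and \<open>\<sigma>\<^sub>2\<close> by \<open>w\<close> visibly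
  1-positive, except for \<open>\<sigma>\<^sub>2\<close> when \<open>w\<close> is a power of it.
\<close>

section \<open>The half-twist\<close>

interpretation B3: group B3
  by (fact group_B3)

lemma carrier_B3 [simp]: "carrier B3 = UNIV"
  by (simp add: B3_def)

abbreviation bmult :: "braid3 \<Rightarrow> braid3 \<Rightarrow> braid3" (infixl "\<star>" 70)
  where "x \<star> y \<equiv> x \<otimes>\<^bsub>B3\<^esub> y"

abbreviation binv :: "braid3 \<Rightarrow> braid3"
  where "binv x \<equiv> inv\<^bsub>B3\<^esub> x"

lemma bmult_cancel [simp]: "binv x \<star> (x \<star> y) = y" "x \<star> (binv x \<star> y) = y"
  by (simp_all flip: B3.m_assoc)

lemmas bgroup = B3.m_assoc B3.inv_mult_group

lemma braid_of_append: "braid_of (u @ v) = braid_of u \<star> braid_of v"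
  unfolding B3_def by simp (transfer, rule braid_eq.refl)

lemma braid_of_Nil: "braid_of [] = \<one>\<^bsub>B3\<^esub>"
  by (simp add: B3_def)

lemma braid_of_letter:
  "braid_of [(S1, True)] = \<sigma>\<^sub>1" "braid_of [(S1, False)] = binv \<sigma>\<^sub>1"
  "braid_of [(S2, True)] = \<sigma>\<^sub>2" "braid_of [(S2, False)] = binv \<sigma>\<^sub>2"
proof -
  have *: "braid_of [(s, False)] = binv (braid_of [(s, True)])" for s
  proof -
    have "braid_of [(s, False), (s, True)] = braid_of []"
      by transfer (use braid_eq.cancel[of "[]" _ False "[]"] in simp)
    then show ?thesis
      using braid_of_append[of "[(s, False)]" "[(s, True)]"]
      by (intro B3.inv_equality[symmetric]) (simp_all add: braid_of_Nil)
  qed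
  show "braid_of [(S1, True)] = \<sigma>\<^sub>1" "braid_of [(S2, True)] = \<sigma>\<^sub>2"
    by (simp_all add: \<sigma>\<^sub>1_def \<sigma>\<^sub>2_def)
  show "braid_of [(S1, False)] = binv \<sigma>\<^sub>1" "braid_of [(S2, False)] = binv \<sigma>\<^sub>2"
    by (simp_all add: \<sigma>\<^sub>1_def \<sigma>\<^sub>2_def *)
qed

lemma braid_of_Cons: "braid_of (l # w) = braid_of [l] \<star> braid_of w"
  using braid_of_append[of "[l]" w] by simp

lemma braid_surj: obtains w where "x = braid_of w"
  by (induction x rule: braid3.abs_induct) (auto simp: braid_of.abs_eq)

lemma braid_relation: "\<sigma>\<^sub>1 \<star> \<sigma>\<^sub>2 \<star> \<sigma>\<^sub>1 = \<sigma>\<^sub>2 \<star> \<sigma>\<^sub>1 \<star> \<sigma>\<^sub>2"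
proof -
  have "braid_of [(S1, True), (S2, True), (S1, True)] = braid_of [(S2, True), (S1, True), (S2, True)]"
    by transfer (use braid_eq.braid[of "[]" "[]"] in simp)
  then show ?thesis
    by (simp add: braid_of_Cons[of _ "_ # _"] braid_of_letter bgroup)
qed

definition Delta :: braid3 where "Delta = \<sigma>\<^sub>1 \<star> \<sigma>\<^sub>2 \<star> \<sigma>\<^sub>1"

lemma Delta_alt: "Delta = \<sigma>\<^sub>2 \<star> \<sigma>\<^sub>1 \<star> \<sigma>\<^sub>2"
  by (simp add: Delta_def braid_relation)

lemma Delta_sigma: "Delta \<star> \<sigma>\<^sub>1 = \<sigma>\<^sub>2 \<star> Delta" "Delta \<star> \<sigma>\<^sub>2 = \<sigma>\<^sub>1 \<star> Delta"
proof -
  show "Delta \<star> \<sigma>\<^sub>1 = \<sigma>\<^sub>2 \<star> Delta"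
    by (subst Delta_alt, subst Delta_def) (simp add: bgroup)
  show "Delta \<star> \<sigma>\<^sub>2 = \<sigma>\<^sub>1 \<star> Delta"
    by (subst Delta_def, subst Delta_alt) (simp add: bgroup)
qed

lemma Delta_binv:
  "Delta \<star> binv \<sigma>\<^sub>1 = binv \<sigma>\<^sub>2 \<star> Delta" "Delta \<star> binv \<sigma>\<^sub>2 = binv \<sigma>\<^sub>1 \<star> Delta"
proof -
  have *: "Delta \<star> binv x = binv y \<star> Delta" if "Delta \<star> x = y \<star> Delta" for x y
  proof -
    have "Delta \<star> binv x = binv y \<star> (y \<star> Delta) \<star> binv x"
      by simp
    also have "\<dots> = binv y \<star> Delta"
      by (simp flip: that add: bgroup)
    finally show ?thesis .
  qed
  show "Delta \<star> binv \<sigma>\<^sub>1 = binv \<sigma>\<^sub>2 \<star> Delta" "Delta \<star> binv \<sigma>\<^sub>2 = binv \<sigma>\<^sub>1 \<star> Delta"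
    by (intro * Delta_sigma)+
qed

text \<open>
  Left multiplication by \<open>\<sigma>\<^sub>2\<close> or \<open>\<sigma>\<^sub>1\<^sup>-\<^sup>1\<close> can leave the monoid generated by \<open>\<sigma>\<^sub>1\<close> and
  \<open>\<sigma>\<^sub>2\<^sup>-\<^sup>1\<close>; these two identities push the damage into a factor \<open>\<Delta>\<close> or \<open>\<Delta>\<^sup>-\<^sup>1\<close>.
\<close>

lemma sigma2_sigma1: "\<sigma>\<^sub>2 \<star> \<sigma>\<^sub>1 = Delta \<star> binv \<sigma>\<^sub>2"
  by (simp add: Delta_alt bgroup)

lemma binv_sigma1: "binv \<sigma>\<^sub>1 = binv Delta \<star> \<sigma>\<^sub>1 \<star> \<sigma>\<^sub>2"
  by (simp add: Delta_def bgroup)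

definition central :: "braid3 \<Rightarrow> bool" where "central z \<longleftrightarrow> (\<forall>x. z \<star> x = x \<star> z)"

lemma central_one: "central \<one>\<^bsub>B3\<^esub>"
  by (simp add: central_def)

lemma central_mult: "central y \<Longrightarrow> central z \<Longrightarrow> central (y \<star> z)"
proof -
  assume y: "central y" and z: "central z"
  have "y \<star> z \<star> x = x \<star> (y \<star> z)" for x
  proof -
    have "y \<star> z \<star> x = y \<star> (z \<star> x)"
      by (simp add: bgroup)
    also have "z \<star> x = x \<star> z"
      using z by (simp add: central_def)
    also have "y \<star> (x \<star> z) = (y \<star> x) \<star> z"
      by (simp add: bgroup)
    also have "y \<star> x = x \<star> y"
      using y by (simp add: central_def)
    finally show ?thesis
      by (simp add: bgroup)
  qed
  then show ?thesis
    by (simp add: central_def)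
qed

lemma central_binv: "central z \<Longrightarrow> central (binv z)"
proof -
  assume z: "central z"
  have "binv z \<star> x = x \<star> binv z" for x
  proof -
    have "binv z \<star> x = binv z \<star> (x \<star> z) \<star> binv z"
      by (simp add: bgroup)
    also have "x \<star> z = z \<star> x"
      using z by (simp add: central_def)
    finally show ?thesis
      by simp
  qed
  then show ?thesis
    by (simp add: central_def)
qed

lemma central_Delta2: "central (Delta \<star> Delta)"
  unfolding central_def
proof
  fix x
  obtain u where x: "x = braid_of u"
    by (rule braid_surj)
  have letter: "Delta \<star> Delta \<star> braid_of [l] = braid_of [l] \<star> (Delta \<star> Delta)" for l
  proof (cases l)
    case (Pair s b)
    have "y \<star> x = x' \<star> y \<Longrightarrow> y \<star> x' = x \<star> y \<Longrightarrow> y \<star> y \<star> x = x \<star> (y \<star> y)" for x x' y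
      by (simp add: bgroup) (simp flip: B3.m_assoc)
    note * = this[OF Delta_sigma(1,2)] this[OF Delta_sigma(2,1)]
      this[OF Delta_binv(1,2)] this[OF Delta_binv(2,1)]
    show ?thesis
      by (cases s; cases b) (simp_all only: Pair braid_of_letter *)
  qed
  show "Delta \<star> Delta \<star> x = x \<star> (Delta \<star> Delta)"
    unfolding x
  proof (induction u)
    case (Cons l u)
    have "Delta \<star> Delta \<star> braid_of (l # u) = (Delta \<star> Delta \<star> braid_of [l]) \<star> braid_of u"
      by (simp add: braid_of_Cons[of l u] bgroup)
    also have "\<dots> = braid_of [l] \<star> (Delta \<star> Delta \<star> braid_of u)"
      by (simp only: letter) (simp add: bgroup)
    also have "\<dots> = braid_of (l # u) \<star> (Delta \<star> Delta)"
      by (simp only: Cons) (simp add: braid_of_Cons[of l u] bgroup)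
    finally show ?case .
  qed (simp add: braid_of_Nil)
qed

section \<open>Braids without negative powers of \<open>\<sigma>\<^sub>1\<close>\<close>

definition nonneg :: "braid3 set" where
  "nonneg = braid_of ` {w. (S1, False) \<notin> set w}"

lemma nonneg_mult: "x \<in> nonneg \<Longrightarrow> y \<in> nonneg \<Longrightarrow> x \<star> y \<in> nonneg"
  unfolding nonneg_def by (clarsimp simp flip: braid_of_append)

lemma P1_nonneg: "x \<in> P\<^sub>1 \<Longrightarrow> y \<in> nonneg \<Longrightarrow> x \<star> y \<in> P\<^sub>1"
  unfolding nonneg_def P\<^sub>1_def one_positive_word_def
  by (clarsimp simp flip: braid_of_append)

lemma nonneg_P1: "x \<in> nonneg \<Longrightarrow> y \<in> P\<^sub>1 \<Longrightarrow> x \<star> y \<in> P\<^sub>1"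
  unfolding nonneg_def P\<^sub>1_def one_positive_word_def
  by (clarsimp simp flip: braid_of_append)

lemma P1_imp_nonneg: "x \<in> P\<^sub>1 \<Longrightarrow> x \<in> nonneg"
  by (auto simp: nonneg_def P\<^sub>1_def one_positive_word_def)

lemma one_nonneg: "\<one>\<^bsub>B3\<^esub> \<in> nonneg"
  by (auto simp: nonneg_def simp flip: braid_of_Nil)

lemma sigma1_P1: "\<sigma>\<^sub>1 \<in> P\<^sub>1"
  unfolding P\<^sub>1_def one_positive_word_def \<sigma>\<^sub>1_def by (rule imageI) simp

lemma sigma2_nonneg: "\<sigma>\<^sub>2 \<in> nonneg" "binv \<sigma>\<^sub>2 \<in> nonneg"
proof -
  have "braid_of [(S2, b)] \<in> nonneg" for b
    unfolding nonneg_def by (rule imageI) simp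
  from this[of True] this[of False] show "\<sigma>\<^sub>2 \<in> nonneg" "binv \<sigma>\<^sub>2 \<in> nonneg"
    by (simp_all add: braid_of_letter)
qed

lemma Delta_P1: "Delta \<in> P\<^sub>1"
  by (simp add: Delta_def P1_nonneg sigma1_P1 sigma2_nonneg P1_imp_nonneg)

abbreviation H2 :: "braid3 set" where "H2 \<equiv> generate B3 {\<sigma>\<^sub>2}"

lemma subgroup_H2: "subgroup H2 B3"
  by (simp add: B3.generate_is_subgroup)

lemma sigma2_H2: "\<sigma>\<^sub>2 \<in> H2" "binv \<sigma>\<^sub>2 \<in> H2"
  by (auto intro: generate.incl generate.inv)

lemma H2_mult: "g \<in> H2 \<Longrightarrow> h \<in> H2 \<Longrightarrow> g \<star> h \<in> H2"
  by (rule generate.eng)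

lemma H2_binv: "h \<in> H2 \<Longrightarrow> binv h \<in> H2"
  by (rule subgroup.m_inv_closed[OF subgroup_H2])

lemma H2_nonneg: "h \<in> H2 \<Longrightarrow> h \<in> nonneg"
  by (induction rule: generate.induct) (auto simp: one_nonneg sigma2_nonneg nonneg_mult)

lemma H2_commute: "g \<in> H2 \<Longrightarrow> h \<in> H2 \<Longrightarrow> g \<star> h = h \<star> g"
  using B3.generate_pow[of \<sigma>\<^sub>2] by (auto simp: B3.int_pow_mult[symmetric] add.commute)

lemma P2_subset_H2: "P\<^sub>2 \<subseteq> H2"
proof -
  have "fst ` set w \<subseteq> {S2} \<Longrightarrow> braid_of w \<in> H2" for w
  proof (induction w)
    case (Cons l w)
    obtain b where "l = (S2, b)"
      using Cons.prems by (cases l) auto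
    then have "braid_of [l] \<in> H2"
      by (cases b) (simp_all add: braid_of_letter sigma2_H2)
    then show ?case
      using Cons by (subst braid_of_Cons) (auto intro: H2_mult)
  qed (simp add: braid_of_Nil generate.one)
  then show ?thesis
    by (auto simp: P\<^sub>2_def two_positive_word_def)
qed

text \<open>
  Inserting powers of \<open>\<sigma>\<^sub>2\<close> of either sign into a 1-positive word keeps it 1-positive, while the other
  half of the cone consists of powers of \<open>\<sigma>\<^sub>2\<close>, which commute with \<open>h\<close>.
\<close>

lemma conj_P_DD:
  assumes z: "central z" and h: "h \<in> H2" and x: "x \<in> P_DD"
  shows "z \<star> h \<star> x \<star> binv (z \<star> h) \<in> P_DD"
proof -
  have "z \<star> h \<star> x \<star> binv (z \<star> h) = z \<star> (h \<star> x \<star> binv h) \<star> binv z"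
    by (simp add: bgroup)
  also have "\<dots> = h \<star> x \<star> binv h"
    using z unfolding central_def by (simp add: bgroup)
  finally have eq: "z \<star> h \<star> x \<star> binv (z \<star> h) = h \<star> x \<star> binv h" .
  from x consider "x \<in> P\<^sub>1" | "x \<in> set_inv\<^bsub>B3\<^esub> P\<^sub>2"
    by (auto simp: P_DD_def)
  then show ?thesis
  proof cases
    case 1
    then have "h \<star> x \<star> binv h \<in> P\<^sub>1"
      by (rule P1_nonneg[OF nonneg_P1[OF H2_nonneg[OF h]] H2_nonneg[OF H2_binv[OF h]]])
    then show ?thesis
      by (simp add: eq P_DD_def)
  next
    case 2
    then have "x \<in> H2"
      using P2_subset_H2 H2_binv by (auto simp: SET_INV_def)
    then have "h \<star> x \<star> binv h = x"
      by (simp add: H2_commute[OF h] bgroup)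
    then show ?thesis
      using x by (simp add: eq)
  qed
qed

section \<open>The monoid generated by \<open>\<sigma>\<^sub>1\<close> and \<open>\<sigma>\<^sub>2\<^sup>-\<^sup>1\<close>\<close>

text \<open>The name refers to the alternating signs of the exponents of the two generators.\<close>

inductive_set alt :: "braid3 set" where
  one: "\<one>\<^bsub>B3\<^esub> \<in> alt"
| sigma1: "w \<in> alt \<Longrightarrow> \<sigma>\<^sub>1 \<star> w \<in> alt"
| sigma2: "w \<in> alt \<Longrightarrow> binv \<sigma>\<^sub>2 \<star> w \<in> alt"

lemma alt_nonneg: "w \<in> alt \<Longrightarrow> w \<in> nonneg"
  by (induction rule: alt.induct)
    (auto intro: one_nonneg nonneg_mult sigma2_nonneg P1_imp_nonneg[OF sigma1_P1])

lemma alt_mult: "v \<in> alt \<Longrightarrow> w \<in> alt \<Longrightarrow> v \<star> w \<in> alt"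
  by (induction rule: alt.induct) (auto simp: bgroup intro: alt.intros)

lemma alt_generator: "\<sigma>\<^sub>1 \<in> alt" "binv \<sigma>\<^sub>2 \<in> alt"
  using alt.sigma1[OF alt.one] alt.sigma2[OF alt.one] by simp_all

text \<open>
  Conjugation by \<open>\<Delta>\<close> exchanges \<open>\<sigma>\<^sub>1\<close> and \<open>\<sigma>\<^sub>2\<close>, so it turns the letters \<open>\<sigma>\<^sub>1\<^sup>-\<^sup>1\<close> and \<open>\<sigma>\<^sub>2\<close>
  of the inverse word back into \<open>\<sigma>\<^sub>2\<^sup>-\<^sup>1\<close> and \<open>\<sigma>\<^sub>1\<close>.
\<close>

lemma alt_inv_Delta: "w \<in> alt \<Longrightarrow> \<exists>v\<in>alt. binv w \<star> Delta = Delta \<star> v"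
proof (induction rule: alt.induct)
  case one
  then show ?case
    using alt.one by force
next
  case (sigma1 w)
  then obtain v where v: "v \<in> alt" "binv w \<star> Delta = Delta \<star> v"
    by blast
  have "binv (\<sigma>\<^sub>1 \<star> w) \<star> Delta = (binv w \<star> Delta) \<star> binv \<sigma>\<^sub>2"
    by (simp add: bgroup Delta_binv)
  also have "\<dots> = Delta \<star> (v \<star> binv \<sigma>\<^sub>2)"
    by (simp add: v bgroup)
  finally show ?case
    using v alt_mult alt_generator by blast
next
  case (sigma2 w)
  then obtain v where v: "v \<in> alt" "binv w \<star> Delta = Delta \<star> v"
    by blast
  have "binv (binv \<sigma>\<^sub>2 \<star> w) \<star> Delta = (binv w \<star> Delta) \<star> \<sigma>\<^sub>1"
    by (simp add: bgroup Delta_sigma)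
  also have "\<dots> = Delta \<star> (v \<star> \<sigma>\<^sub>1)"
    by (simp add: v bgroup)
  finally show ?case
    using v alt_mult alt_generator by blast
qed

lemma alt_inv_Delta_P1: "w \<in> alt \<Longrightarrow> binv w \<star> Delta \<in> P\<^sub>1"
  using alt_inv_Delta P1_nonneg[OF Delta_P1] alt_nonneg by metis

text \<open>
  A first letter of \<open>w\<close> that commutes with the conjugated generator drops out. Any other first letter
  produces the factor \<open>\<sigma>\<^sub>2 \<sigma>\<^sub>1 = \<Delta> \<sigma>\<^sub>2\<^sup>-\<^sup>1\<close>, and this \<open>\<Delta>\<close> absorbs the inverse word on its left.
\<close>

lemma alt_conj_sigma1: "w \<in> alt \<Longrightarrow> binv w \<star> \<sigma>\<^sub>1 \<star> w \<in> P\<^sub>1"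
proof (induction rule: alt.induct)
  case one
  then show ?case
    by (simp add: sigma1_P1)
next
  case (sigma1 w)
  then show ?case
    by (simp add: bgroup)
next
  case (sigma2 w)
  have "binv (binv \<sigma>\<^sub>2 \<star> w) \<star> \<sigma>\<^sub>1 \<star> (binv \<sigma>\<^sub>2 \<star> w) = binv w \<star> (\<sigma>\<^sub>2 \<star> \<sigma>\<^sub>1) \<star> (binv \<sigma>\<^sub>2 \<star> w)"
    by (simp add: bgroup)
  also have "\<dots> = (binv w \<star> Delta) \<star> (binv \<sigma>\<^sub>2 \<star> (binv \<sigma>\<^sub>2 \<star> w))"
    unfolding sigma2_sigma1 by (simp add: bgroup)
  finally show ?case
    using sigma2 by (simp add: P1_nonneg alt_inv_Delta_P1 nonneg_mult sigma2_nonneg alt_nonneg)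
qed

lemma alt_conj_sigma2: "w \<in> alt \<Longrightarrow> binv w \<star> \<sigma>\<^sub>2 \<star> w \<in> P\<^sub>1 \<or> w \<in> H2"
proof (induction rule: alt.induct)
  case one
  then show ?case
    by (simp add: generate.one)
next
  case (sigma1 w)
  have "binv (\<sigma>\<^sub>1 \<star> w) \<star> \<sigma>\<^sub>2 \<star> (\<sigma>\<^sub>1 \<star> w) = binv (\<sigma>\<^sub>1 \<star> w) \<star> (\<sigma>\<^sub>2 \<star> \<sigma>\<^sub>1) \<star> w"
    by (simp add: bgroup)
  also have "\<dots> = (binv (\<sigma>\<^sub>1 \<star> w) \<star> Delta) \<star> (binv \<sigma>\<^sub>2 \<star> w)"
    unfolding sigma2_sigma1 by (simp add: bgroup)
  finally show ?case
    using sigma1 alt_inv_Delta_P1[OF alt.sigma1[of w]]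
    by (simp add: P1_nonneg nonneg_mult sigma2_nonneg alt_nonneg)
next
  case (sigma2 w)
  then show ?case
    by (auto simp: bgroup intro: H2_mult sigma2_H2)
qed

section \<open>A normal form for braids\<close>

definition decomposed :: "braid3 set" where
  "decomposed = {z \<star> d \<star> w \<star> h | z d w h.
     central z \<and> d \<in> {\<one>\<^bsub>B3\<^esub>, Delta} \<and> w \<in> alt \<and> h \<in> H2}"

lemma decomposedI:
  "central z \<Longrightarrow> d \<in> {\<one>\<^bsub>B3\<^esub>, Delta} \<Longrightarrow> w \<in> alt \<Longrightarrow> h \<in> H2 \<Longrightarrow> z \<star> d \<star> w \<star> h \<in> decomposed"
  unfolding decomposed_def by fast

lemma decomposedE:
  assumes "x \<in> decomposed"
  obtains z d w h where "x = z \<star> d \<star> w \<star> h" "central z" "d \<in> {\<one>\<^bsub>B3\<^esub>, Delta}" "w \<in> alt" "h \<in> H2"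
  using assms unfolding decomposed_def by blast

lemma decomposed_central:
  assumes y: "central y" and x: "x \<in> decomposed" shows "y \<star> x \<in> decomposed"
proof -
  from x obtain z d w h where *: "x = z \<star> d \<star> w \<star> h" "central z" "d \<in> {\<one>\<^bsub>B3\<^esub>, Delta}" "w \<in> alt" "h \<in> H2"
    by (rule decomposedE)
  have "y \<star> x = (y \<star> z) \<star> d \<star> w \<star> h"
    by (simp only: *(1) bgroup UNIV_I carrier_B3)
  also have "\<dots> \<in> decomposed"
    by (rule decomposedI[OF central_mult[OF y *(2)] *(3-5)])
  finally show ?thesis .
qed

lemma decomposed_Delta:
  assumes "x \<in> decomposed" shows "Delta \<star> x \<in> decomposed"
proof -
  from assms obtain z d w h where *: "x = z \<star> d \<star> w \<star> h" "central z" "d \<in> {\<one>\<^bsub>B3\<^esub>, Delta}" "w \<in> alt" "h \<in> H2"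
    by (rule decomposedE)
  have "Delta \<star> x = (Delta \<star> z) \<star> (d \<star> w \<star> h)"
    by (simp only: * bgroup UNIV_I carrier_B3)
  also have "Delta \<star> z = z \<star> Delta"
    using *(2) by (simp add: central_def)
  finally have eq: "Delta \<star> x = z \<star> Delta \<star> (d \<star> w \<star> h)" .
  show ?thesis
  proof (cases "d = \<one>\<^bsub>B3\<^esub>")
    case True
    then have "Delta \<star> x = z \<star> Delta \<star> w \<star> h"
      by (simp add: eq bgroup)
    also have "\<dots> \<in> decomposed"
      using *(2,4,5) by (simp add: decomposedI)
    finally show ?thesis .
  next
    case False
    then have "Delta \<star> x = (z \<star> (Delta \<star> Delta)) \<star> \<one>\<^bsub>B3\<^esub> \<star> w \<star> h"
      using *(3) by (simp add: eq bgroup)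
    also have "\<dots> \<in> decomposed"
      using decomposedI[OF central_mult[OF *(2) central_Delta2] _ *(4,5)] by blast
    finally show ?thesis .
  qed
qed

lemma decomposed_binv_Delta:
  assumes "x \<in> decomposed" shows "binv Delta \<star> x \<in> decomposed"
proof -
  have "binv Delta \<star> x = binv (Delta \<star> Delta) \<star> (Delta \<star> x)"
    by (simp add: bgroup)
  then show ?thesis
    using decomposed_central[OF central_binv[OF central_Delta2] decomposed_Delta[OF assms]] by simp
qed

lemma decomposed_alt: "w \<in> alt \<Longrightarrow> h \<in> H2 \<Longrightarrow> w \<star> h \<in> decomposed"
  using decomposedI[OF central_one, of "\<one>\<^bsub>B3\<^esub>"] by simp

text \<open>
  A letter inverse to the first letter of \<open>w\<close> cancels. Otherwise a factor \<open>\<Delta>\<close> or \<open>\<Delta>\<^sup>-\<^sup>1\<close> splits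
  off; when \<open>w\<close> is trivial, the power of \<open>\<sigma>\<^sub>2\<close> on the right absorbs what is left.
\<close>

lemma decomposed_sigma2_alt:
  assumes w: "w \<in> alt" and h: "h \<in> H2" shows "\<sigma>\<^sub>2 \<star> (w \<star> h) \<in> decomposed"
  using w
proof cases
  case one
  then show ?thesis
    using decomposed_alt[OF alt.one H2_mult[OF sigma2_H2(1) h]] by simp
next
  case (sigma1 v)
  have "\<sigma>\<^sub>2 \<star> (w \<star> h) = (\<sigma>\<^sub>2 \<star> \<sigma>\<^sub>1) \<star> (v \<star> h)"
    by (simp add: sigma1 bgroup)
  also have "\<dots> = Delta \<star> ((binv \<sigma>\<^sub>2 \<star> v) \<star> h)"
    by (subst sigma2_sigma1) (simp add: bgroup)
  finally show ?thesis
    using decomposed_Delta[OF decomposed_alt[OF alt.sigma2 h]] sigma1 by simp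
next
  case (sigma2 v)
  then show ?thesis
    using decomposed_alt h by (simp add: bgroup)
qed

lemma decomposed_binv_sigma1_alt:
  assumes w: "w \<in> alt" and h: "h \<in> H2" shows "binv \<sigma>\<^sub>1 \<star> (w \<star> h) \<in> decomposed"
proof -
  have eq: "binv \<sigma>\<^sub>1 \<star> (w \<star> h) = binv Delta \<star> (\<sigma>\<^sub>1 \<star> (\<sigma>\<^sub>2 \<star> w \<star> h))"
    by (subst binv_sigma1) (simp add: bgroup)
  from w show ?thesis
  proof cases
    case one
    then show ?thesis
      unfolding eq
      using decomposed_binv_Delta[OF decomposed_alt[OF alt_generator(1) H2_mult[OF sigma2_H2(1) h]]]
      by simp
  next
    case (sigma1 v)
    then show ?thesis
      using decomposed_alt h by (simp add: bgroup)
  next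
    case (sigma2 v)
    then show ?thesis
      unfolding eq
      using decomposed_binv_Delta[OF decomposed_alt[OF alt.sigma1[of v] h]] by (simp add: bgroup)
  qed
qed

lemma decomposed_letter:
  assumes x: "x \<in> decomposed" shows "braid_of [l] \<star> x \<in> decomposed"
proof -
  have base: "braid_of [l] \<star> (w \<star> h) \<in> decomposed" if "w \<in> alt" "h \<in> H2" for w h l
  proof (cases l)
    case (Pair s b)
    have "\<sigma>\<^sub>1 \<star> (w \<star> h) \<in> decomposed" "binv \<sigma>\<^sub>2 \<star> (w \<star> h) \<in> decomposed"
      using decomposed_alt[OF alt.sigma1 that(2)] decomposed_alt[OF alt.sigma2 that(2)] that
      by (simp_all add: bgroup)
    then show ?thesis
      using decomposed_sigma2_alt decomposed_binv_sigma1_alt that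
      by (cases s; cases b) (simp_all add: Pair braid_of_letter)
  qed
  from x obtain z d w h where *: "x = z \<star> d \<star> w \<star> h" "central z" "d \<in> {\<one>\<^bsub>B3\<^esub>, Delta}" "w \<in> alt" "h \<in> H2"
    by (rule decomposedE)
  have "braid_of [l] \<star> (d \<star> (w \<star> h)) \<in> decomposed"
  proof (cases "d = \<one>\<^bsub>B3\<^esub>")
    case True
    then show ?thesis
      using base * by simp
  next
    case False
    obtain l' where l': "braid_of [l] \<star> Delta = Delta \<star> braid_of [l']"
    proof -
      obtain s b where "l = (s, b)"
        by force
      then show thesis
        using that[of "(if s = S1 then S2 else S1, b)"]
        by (cases s; cases b) (simp_all add: braid_of_letter Delta_sigma Delta_binv)
    qed
    have "braid_of [l] \<star> (d \<star> (w \<star> h)) = (braid_of [l] \<star> Delta) \<star> (w \<star> h)"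
      using False *(3) by (simp add: bgroup)
    also have "\<dots> = Delta \<star> (braid_of [l'] \<star> (w \<star> h))"
      by (simp add: l' bgroup)
    finally show ?thesis
      using decomposed_Delta base * by simp
  qed
  then have "z \<star> (braid_of [l] \<star> (d \<star> (w \<star> h))) \<in> decomposed"
    by (rule decomposed_central[OF *(2)])
  also have "z \<star> (braid_of [l] \<star> (d \<star> (w \<star> h))) = (z \<star> braid_of [l]) \<star> (d \<star> (w \<star> h))"
    by (simp only: bgroup UNIV_I carrier_B3)
  also have "z \<star> braid_of [l] = braid_of [l] \<star> z"
    using *(2) by (simp add: central_def)
  finally show ?thesis
    by (simp add: * bgroup)
qed

lemma braid_decomp: "x \<in> decomposed"
proof -
  have "braid_of u \<in> decomposed" for u
  proof (induction u)
    case Nil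
    then show ?case
      using decomposed_alt[OF alt.one generate.one] by (simp add: braid_of_Nil)
  next
    case (Cons l u)
    then show ?case
      by (subst braid_of_Cons) (rule decomposed_letter)
  qed
  then show ?thesis
    by (metis braid_surj)
qed

text \<open>
  The central factor does not affect the conjugate, and the power of \<open>\<sigma>\<^sub>2\<close> preserves \<open>P\<^sub>1\<close>. The factor
  \<open>\<Delta>\<close> replaces \<open>\<sigma>\<^sub>2\<close> by \<open>\<sigma>\<^sub>1\<close>, all of whose conjugates by the monoid are 1-positive.
\<close>

lemma conj_sigma2:
  obtains z h where "central z" "h \<in> H2" "x = z \<star> h"
  | "binv x \<star> \<sigma>\<^sub>2 \<star> x \<in> P\<^sub>1"
proof -
  obtain z d w h where *: "x = z \<star> d \<star> w \<star> h" "central z" "d \<in> {\<one>\<^bsub>B3\<^esub>, Delta}" "w \<in> alt" "h \<in> H2"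
    using braid_decomp[of x] by (rule decomposedE)
  have h: "binv h \<star> y \<star> h \<in> P\<^sub>1" if "y \<in> P\<^sub>1" for y
    by (rule P1_nonneg[OF nonneg_P1[OF H2_nonneg[OF H2_binv[OF *(5)]] that] H2_nonneg[OF *(5)]])
  have "binv z \<star> (\<sigma>\<^sub>2 \<star> (z \<star> y)) = \<sigma>\<^sub>2 \<star> y" for y
  proof -
    have "\<sigma>\<^sub>2 \<star> (z \<star> y) = (\<sigma>\<^sub>2 \<star> z) \<star> y"
      by (simp add: bgroup)
    also have "\<sigma>\<^sub>2 \<star> z = z \<star> \<sigma>\<^sub>2"
      using *(2) by (simp add: central_def)
    finally show ?thesis
      by (simp add: bgroup)
  qed
  then have eq: "binv x \<star> \<sigma>\<^sub>2 \<star> x = binv h \<star> (binv w \<star> (binv d \<star> \<sigma>\<^sub>2 \<star> d) \<star> w) \<star> h"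
    by (simp add: *(1) bgroup)
  show thesis
  proof (cases "d = \<one>\<^bsub>B3\<^esub>")
    case True
    then have eq': "binv x \<star> \<sigma>\<^sub>2 \<star> x = binv h \<star> (binv w \<star> \<sigma>\<^sub>2 \<star> w) \<star> h"
      by (simp add: eq)
    from alt_conj_sigma2[OF *(4)] show thesis
    proof
      assume "binv w \<star> \<sigma>\<^sub>2 \<star> w \<in> P\<^sub>1"
      then show thesis
        using that(2) h by (simp add: eq')
    next
      assume "w \<in> H2"
      then show thesis
        using that(1)[OF *(2) H2_mult[OF _ *(5)]] True by (simp add: * bgroup)
    qed
  next
    case False
    then have "binv d \<star> \<sigma>\<^sub>2 \<star> d = \<sigma>\<^sub>1"
      using *(3) by (simp add: bgroup Delta_sigma(1)[symmetric])
    then show thesis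
      using that(2) h alt_conj_sigma1[OF *(4)] by (simp add: eq)
  qed
qed

section \<open>Conjugates of the Dubrovina--Dubrovin ordering of the free subgroup\<close>

lemma F2_mult: "x \<otimes>\<^bsub>F2\<^esub> y = x \<star> y"
  by (simp add: F2_def)

lemma F2_one: "\<one>\<^bsub>F2\<^esub> = \<one>\<^bsub>B3\<^esub>"
  by (simp add: F2_def)

lemma subgroup_F2: "subgroup (carrier F2) B3"
  unfolding F2_def by (simp add: B3.generate_is_subgroup)

lemma F2_inv: "x \<in> carrier F2 \<Longrightarrow> inv\<^bsub>F2\<^esub> x = binv x"
  using B3.m_inv_consistent[OF subgroup_F2, of x] by (simp add: F2_def)

lemma F2_conj:
  "(\<beta> <#\<^bsub>F2\<^esub> A) #>\<^bsub>F2\<^esub> y = (\<lambda>x. \<beta> \<star> x \<star> y) ` A"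
  by (auto simp: l_coset_def r_coset_def F2_mult)

lemma positive_cone_ord_C:
  "positive_cone F2 ord_C = {x \<in> carrier F2. x \<noteq> \<one>\<^bsub>B3\<^esub> \<and> x \<in> P_DD}"
proof -
  interpret F2: group F2
    by (rule group_F2)
  show ?thesis
    using F2.one_closed
    by (auto simp: positive_cone_def ord_C_def cone_order_def F2_one F2_mult F2_inv[OF F2.one_closed, unfolded F2_one])
qed

text \<open>The abelianization of \<open>B3\<close>, which shows that \<open>\<sigma>\<^sub>2\<^sup>2\<close> is nontrivial.\<close>

fun exponent_sum :: "word \<Rightarrow> int" where
  "exponent_sum [] = 0"
| "exponent_sum ((s, b) # w) = (if b then 1 else -1) + exponent_sum w"

lemma exponent_sum_append: "exponent_sum (u @ v) = exponent_sum u + exponent_sum v"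
  by (induction u rule: exponent_sum.induct) auto

lemma exponent_sum_cong: "braid_eq u v \<Longrightarrow> exponent_sum u = exponent_sum v"
  by (induction rule: braid_eq.induct) (auto simp: exponent_sum_append)

definition sigma2_sq :: braid3 where "sigma2_sq = \<sigma>\<^sub>2 \<star> \<sigma>\<^sub>2"

lemma sigma2_int_pow: "\<sigma>\<^sub>2 [^]\<^bsub>B3\<^esub> (-2::int) = binv sigma2_sq"
  using B3.int_pow_neg[of \<sigma>\<^sub>2 2] B3.int_pow_mult[of \<sigma>\<^sub>2 1 1]
  by (simp add: sigma2_sq_def)

lemma sigma2_sq_F2: "sigma2_sq \<in> carrier F2"
  by (auto simp: F2_def sigma2_sq_def numeral_2_eq_2 intro: generate.incl)

lemma sigma2_sq_neq_one: "sigma2_sq \<noteq> \<one>\<^bsub>B3\<^esub>"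
proof -
  have "\<not> braid_eq [(S2, True), (S2, True)] []"
    using exponent_sum_cong by fastforce
  then have "braid_of [(S2, True), (S2, True)] \<noteq> braid_of []"
    by transfer
  then show ?thesis
    using braid_of_append[of "[(S2, True)]" "[(S2, True)]"]
    by (simp add: sigma2_sq_def braid_of_Nil braid_of_letter)
qed

lemma binv_sigma2_sq_neq_one: "binv sigma2_sq \<noteq> \<one>\<^bsub>B3\<^esub>"
  using sigma2_sq_neq_one by (metis B3.inv_inv B3.inv_one UNIV_I carrier_B3)

lemma binv_sigma2_sq_F2: "binv sigma2_sq \<in> carrier F2"
  using sigma2_sq_F2 by (rule subgroup.m_inv_closed[OF subgroup_F2])

lemma binv_sigma2_sq_P_DD: "binv sigma2_sq \<in> P_DD"
proof -
  have "braid_of ([(S2, True)] @ [(S2, True)]) \<in> P\<^sub>2"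
    unfolding P\<^sub>2_def two_positive_word_def by (rule imageI) simp
  then have "sigma2_sq \<in> P\<^sub>2"
    by (simp only: sigma2_sq_def braid_of_append braid_of_letter)
  then show ?thesis
    by (auto simp: P_DD_def SET_INV_def)
qed

lemma cone_antisym:
  assumes "group G" "r \<in> left_orderings G" "f \<in> positive_cone G r"
  shows "inv\<^bsub>G\<^esub> f \<notin> positive_cone G r"
proof
  interpret group G by fact
  assume "inv\<^bsub>G\<^esub> f \<in> positive_cone G r"
  then have "(\<one>\<^bsub>G\<^esub>, inv\<^bsub>G\<^esub> f) \<in> r" and f: "f \<in> carrier G" "f \<noteq> \<one>\<^bsub>G\<^esub>" "(\<one>\<^bsub>G\<^esub>, f) \<in> r"
    using assms(3) by (auto simp: positive_cone_def)
  then have "(f \<otimes>\<^bsub>G\<^esub> \<one>\<^bsub>G\<^esub>, f \<otimes>\<^bsub>G\<^esub> inv\<^bsub>G\<^esub> f) \<in> r"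
    using assms(2) unfolding left_orderings_def by blast
  then have "(f, \<one>\<^bsub>G\<^esub>) \<in> r"
    using f by simp
  moreover have "antisym r"
    using assms(2) by (auto simp: left_orderings_def linear_order_on_def partial_order_on_def)
  ultimately show False
    using f by (auto dest: antisymD)
qed

lemma conj_cone:
  assumes \<beta>: "\<beta> \<in> carrier F2" "\<beta> = z \<star> h" "central z" "h \<in> H2"
  shows "(\<lambda>x. \<beta> \<star> x \<star> binv \<beta>) ` positive_cone F2 ord_C = positive_cone F2 ord_C"
proof -
  have sub: "\<gamma> \<star> x \<star> binv \<gamma> \<in> positive_cone F2 ord_C"
    if \<gamma>: "\<gamma> \<in> carrier F2" "\<gamma> = y \<star> g" "central y" "g \<in> H2"
      and x: "x \<in> positive_cone F2 ord_C" for \<gamma> y g x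
  proof -
    have "\<gamma> \<star> x \<star> binv \<gamma> \<in> carrier F2"
      using \<gamma>(1) x subgroup.m_closed[OF subgroup_F2] subgroup.m_inv_closed[OF subgroup_F2]
      by (simp add: positive_cone_ord_C)
    moreover have "\<gamma> \<star> x \<star> binv \<gamma> \<noteq> \<one>\<^bsub>B3\<^esub>"
    proof
      assume "\<gamma> \<star> x \<star> binv \<gamma> = \<one>\<^bsub>B3\<^esub>"
      then have "binv \<gamma> \<star> (\<gamma> \<star> x \<star> binv \<gamma>) \<star> \<gamma> = \<one>\<^bsub>B3\<^esub>"
        by simp
      then show False
        using x by (simp add: bgroup positive_cone_ord_C)
    qed
    ultimately show ?thesis
      using x conj_P_DD[OF \<gamma>(3,4), of x] by (simp add: positive_cone_ord_C \<gamma>(2))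
  qed
  have "binv h \<star> binv z = binv z \<star> binv h"
    using central_binv[OF \<beta>(3)] by (simp add: central_def)
  then have inv: "binv \<beta> = binv z \<star> binv h"
    by (simp add: \<beta>(2) bgroup)
  have "x \<in> (\<lambda>x. \<beta> \<star> x \<star> binv \<beta>) ` positive_cone F2 ord_C" if "x \<in> positive_cone F2 ord_C" for x
  proof
    show "x = \<beta> \<star> (binv \<beta> \<star> x \<star> binv (binv \<beta>)) \<star> binv \<beta>"
      by (simp add: bgroup)
    show "binv \<beta> \<star> x \<star> binv (binv \<beta>) \<in> positive_cone F2 ord_C"
      using sub[OF _ inv central_binv[OF \<beta>(3)] H2_binv[OF \<beta>(4)] that]
        subgroup.m_inv_closed[OF subgroup_F2 \<beta>(1)] by simp
  qed
  then show ?thesis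
    using sub[OF \<beta>] by blast
qed

text \<open>
  If the conjugating element moves the cone, it makes \<open>\<sigma>\<^sub>2\<^sup>2\<close> positive, and the contradiction comes
  from the antisymmetry of \<open>r\<close>.
\<close>

lemma conjugate_eq_ord_C:
  assumes r: "r \<in> conjugates F2 ord_C" and pos: "binv sigma2_sq \<in> positive_cone F2 r"
  shows "r = ord_C"
proof -
  from r obtain \<beta> where lo: "r \<in> left_orderings F2" and \<beta>: "\<beta> \<in> carrier F2"
    and cone: "positive_cone F2 r = (\<lambda>x. \<beta> \<star> x \<star> binv \<beta>) ` positive_cone F2 ord_C"
    by (auto simp: conjugates_def F2_conj F2_inv)
  show ?thesis
  proof (cases rule: conj_sigma2[of \<beta>])
    case (1 z h)
    then have "positive_cone F2 r = positive_cone F2 ord_C"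
      using conj_cone[OF \<beta>] cone by blast
    then have "r = cone_order F2 {x \<in> carrier F2. x \<noteq> \<one>\<^bsub>B3\<^esub> \<and> x \<in> P_DD}"
      using cone_order_positive_cone[OF group_F2 lo] by (simp add: positive_cone_ord_C)
    also have "\<dots> = ord_C"
    proof -
      interpret F2: group F2
        by (rule group_F2)
      have "inv\<^bsub>F2\<^esub> a \<otimes>\<^bsub>F2\<^esub> b = \<one>\<^bsub>F2\<^esub> \<longleftrightarrow> a = b" if "a \<in> carrier F2" "b \<in> carrier F2" for a b
        using that by (metis F2.inv_solve_left' F2.one_closed F2.r_one)
      then show ?thesis
        unfolding ord_C_def cone_order_def F2_one by auto
    qed
    finally show ?thesis .
  next
    case 2
    let ?x = "binv \<beta> \<star> sigma2_sq \<star> \<beta>"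
    have conj_back: "\<beta> \<star> ?x \<star> binv \<beta> = sigma2_sq"
      by (simp add: bgroup)
    have "?x = (binv \<beta> \<star> \<sigma>\<^sub>2 \<star> \<beta>) \<star> (binv \<beta> \<star> \<sigma>\<^sub>2 \<star> \<beta>)"
      by (simp add: sigma2_sq_def bgroup)
    then have "?x \<in> P_DD"
      using 2 P1_nonneg P1_imp_nonneg by (simp add: P_DD_def)
    moreover have "?x \<in> carrier F2"
      using \<beta> sigma2_sq_F2 subgroup.m_closed[OF subgroup_F2] subgroup.m_inv_closed[OF subgroup_F2]
      by simp
    moreover have "?x \<noteq> \<one>\<^bsub>B3\<^esub>"
      using conj_back sigma2_sq_neq_one by (metis B3.r_inv B3.r_one UNIV_I carrier_B3)
    ultimately have "?x \<in> positive_cone F2 ord_C"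
      by (simp add: positive_cone_ord_C)
    then have "sigma2_sq \<in> positive_cone F2 r"
      unfolding cone using conj_back by (metis image_eqI)
    then show ?thesis
      using cone_antisym[OF group_F2 lo, of sigma2_sq] pos by (simp add: F2_inv sigma2_sq_F2)
  qed
qed

theorem propositionA4:
  shows "ord_C \<notin> LO_topology F2 derived_set_of conjugates F2 ord_C \<and>
         (\<forall>r\<in>conjugates F2 ord_C. r \<noteq> ord_C \<longrightarrow> r \<notin> pos_open F2 (\<sigma>\<^sub>2 [^]\<^bsub>B3\<^esub> (-2::int)))"
proof -
  have 2: "r \<notin> pos_open F2 (\<sigma>\<^sub>2 [^]\<^bsub>B3\<^esub> (-2::int))"
    if "r \<in> conjugates F2 ord_C" "r \<noteq> ord_C" for r
    using conjugate_eq_ord_C that by (auto simp: pos_open_def sigma2_int_pow)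
  have "ord_C \<notin> LO_topology F2 derived_set_of conjugates F2 ord_C"
  proof
    assume *: "ord_C \<in> LO_topology F2 derived_set_of conjugates F2 ord_C"
    then have "ord_C \<in> left_orderings F2"
      by (simp add: in_derived_set_of)
    then have "ord_C \<in> pos_open F2 (\<sigma>\<^sub>2 [^]\<^bsub>B3\<^esub> (-2::int))"
      by (simp add: pos_open_def sigma2_int_pow positive_cone_ord_C
          binv_sigma2_sq_F2 binv_sigma2_sq_neq_one binv_sigma2_sq_P_DD)
    moreover have "openin (LO_topology F2) (pos_open F2 (\<sigma>\<^sub>2 [^]\<^bsub>B3\<^esub> (-2::int)))"
      by (rule openin_pos_open)
        (simp_all add: sigma2_int_pow F2_one binv_sigma2_sq_F2 binv_sigma2_sq_neq_one)
    ultimately obtain r where "r \<noteq> ord_C" "r \<in> conjugates F2 ord_C"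
      "r \<in> pos_open F2 (\<sigma>\<^sub>2 [^]\<^bsub>B3\<^esub> (-2::int))"
      using * unfolding in_derived_set_of by blast
    then show False
      using 2 by blast
  qed
  then show ?thesis
    using 2 by blast
qed

end
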